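(* Let $(X,\mathcal{M},\mu)$ be a measure space and let $f : X \to \mathbb{R}$ be a measurable function. For real $1\leq p<\infty$ and $q>0$ let $B_{pq}(t)=t^p\log(e_0+t)^q$ for $t\ge 0$, where $e_0=e-1$. If for some $p$ with $1\le p<\infty$ and some $q_0>0$ we have $\|f\|_{B_{pq_0}}<\infty$, then, for this same fixed $p$, \[ \lim_{q\rightarrow \infty} \|f\|_{B_{pq}} = \|f\|_\infty , \] where the norms are the Luxemburg norms associated with $B_{pq}$, and both sides are understood as elements of $[0,\infty]$ (so that if $\|f\|_\infty=\infty$ the limit is $\infty$).
   Context: For a Young function $A:[0,\infty)\to[0,\infty)$ (continuous, convex, increasing, $A(0)=0$, and $A(t)/t\to\infty$ as $t\to\infty$) and a measurable real-valued function $f$ on $X$, the Orlicz (Luxemburg) norm is \[ \|f\|_A = \inf\bigg\{ \lambda > 0 : \int_X A\bigg(\frac{|f(x)|}{\lambda}\bigg)\,d\mu \leq 1 \bigg\}, \] with the convention $\inf\emptyset=\infty$. This definition is applied with $A=B_{pq}$. Here $\log(e_0+t)^q$ means $(\log(e_0+t))^q$, with $\log$ the natural logarithm and $e$ its base. $\|f\|_\infty\in[0,\infty]$ is the essential supremum of $|f|$ with respect to $\mu$. The parameter $q$ tends to infinity through positive real numbers. *)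

theory Defs
  imports "HOL-Probability.Essential_Supremum"
begin

text \<open>
  The Luxemburg norm takes values in \<open>[0,\<infinity>]\<close>, represented by \<^typ>\<open>ennreal\<close>, in which the
  infimum of the empty set is \<open>\<infinity>\<close>.  Only the values of \<open>A\<close> on \<open>[0,\<infinity>)\<close> matter; there \<open>A\<close> is
  meant to be nonnegative, so that the truncation of negative reals by \<^const>\<open>ennreal\<close> plays no
  role.
\<close>

definition luxemburg_norm :: "'a measure \<Rightarrow> (real \<Rightarrow> real) \<Rightarrow> ('a \<Rightarrow> real) \<Rightarrow> ennreal" where
  "luxemburg_norm M A f =
     Inf {ennreal l | l::real. l > 0 \<and> (\<integral>\<^sup>+ x. ennreal (A (\<bar>f x\<bar> / l)) \<partial>M) \<le> 1}"

text \<open>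
  For \<open>t \<ge> 0\<close> and \<open>p > 0\<close> the real powers agree with the usual ones: \<open>0 powr p = 0\<close>, and
  \<open>ln (exp 1 - 1 + t) > 0\<close> because \<open>exp 1 - 1 > 1\<close>.
\<close>

definition B :: "real \<Rightarrow> real \<Rightarrow> real \<Rightarrow> real" where
  "B p q t = t powr p * ln (exp 1 - 1 + t) powr q"

text \<open>
  The essential supremum is taken in \<^typ>\<open>ennreal\<close>, whose least element is \<open>0\<close>; this gives
  \<open>0\<close>, and not \<open>-\<infinity>\<close>, on a null measure space.
\<close>

definition Linf_norm :: "'a measure \<Rightarrow> ('a \<Rightarrow> real) \<Rightarrow> ennreal" where
  "Linf_norm M f = esssup M (\<lambda>x. ennreal \<bar>f x\<bar>)"

end

theory Submission
  imports Defs "HOL-Real_Asymp.Real_Asymp"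
begin

text \<open>The factor \<open>ln (exp 1 - 1 + t)\<close> crosses the value 1 at t = 1, so a large
  exponent q crushes it for t < 1 and blows it up for t > 1. If c exceeds the essential supremum,
  the factor along \<open>\<bar>f x\<bar> / c\<close> is almost everywhere at most some s < 1. The
  modular for q is then at most s^(q - q0) times the modular for q0, hence eventually at most 1, and
  c bounds the norm (\<open>eventually_luxemburg_norm_le\<close>). The modular for q0 must be finite
  at every scale c, whereas a finite norm gives this at one scale only; the doubling property
  \<open>B_doubling\<close> closes the gap. If d lies below the essential supremum, then
  \<open>\<bar>f x\<bar>\<close> exceeds some d' > d on a set of positive measure. There the modular
  at any scale l < d grows at least like r^q with r > 1, so eventually no such l is admissible
  (\<open>eventually_luxemburg_norm_ge\<close>).\<close>

lemma e0_gt_1: "1 < exp 1 - (1::real)"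
proof -
  \<comment> \<open>This yields e >= 9/4 > 2.\<close>
  have "(3/2)\<^sup>2 \<le> (exp (1/2 :: real))\<^sup>2"
    using exp_ge_add_one_self[of "1/2::real"] by (intro power_mono) auto
  also have "(exp (1/2 :: real))\<^sup>2 = exp 1"
    by (simp flip: exp_of_nat_mult)
  finally show ?thesis by (simp add: power2_eq_square)
qed

lemma ln_e0_add_pos: "0 \<le> t \<Longrightarrow> 0 < ln (exp 1 - 1 + t)" for t :: real
  using e0_gt_1 by (intro ln_gt_zero) linarith

lemma ln_e0_add_mono: "0 \<le> s \<Longrightarrow> s \<le> t \<Longrightarrow> ln (exp 1 - 1 + s) \<le> ln (exp 1 - 1 + t)" for t :: real
  using e0_gt_1 by simp

lemma B_nonneg: "0 \<le> B p q t"
  by (simp add: B_def)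

lemma B_mono:
  assumes "0 \<le> p" "0 \<le> q" "0 \<le> s" "s \<le> t"
  shows "B p q s \<le> B p q t"
  unfolding B_def using assms ln_e0_add_mono[of s t] ln_e0_add_pos[of s]
  by (intro mult_mono powr_mono2) auto

lemma B_measurable [measurable]: "B p q \<in> borel_measurable borel"
  unfolding B_def[abs_def] by measurable

text \<open>The power scales exactly. In the logarithm, scaling by k adds at most
  \<open>ln k\<close>, which is a bounded multiple of the logarithm itself because that is at least
  \<open>ln e0\<close> > 0.\<close>

lemma B_doubling:
  assumes "0 \<le> p" "0 \<le> q" "1 \<le> k"
  obtains C where "0 \<le> C" "\<And>t. 0 \<le> t \<Longrightarrow> B p q (k * t) \<le> C * B p q t"
proof
  define e0 :: real where "e0 = exp 1 - 1"
  note e0 = e0_gt_1[folded e0_def]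
  define K where "K = 1 + ln k / ln e0"
  have K: "1 \<le> K"
    using assms e0 by (simp add: K_def)
  show "0 \<le> k powr p * K powr q"
    by simp
  fix t :: real assume t: "0 \<le> t"
  have "e0 * 1 \<le> e0 * k"
    using assms e0 by (intro mult_left_mono) auto
  hence "ln (e0 + k * t) \<le> ln (k * (e0 + t))"
    using e0 t assms by (subst ln_le_cancel_iff) (auto simp: algebra_simps add_pos_nonneg)
  also have "\<dots> = ln k / ln e0 * ln e0 + ln (e0 + t)"
    using e0 t assms by (simp add: ln_mult)
  also have "\<dots> \<le> ln k / ln e0 * ln (e0 + t) + ln (e0 + t)"
    using e0 t assms by (intro add_right_mono mult_left_mono) auto
  also have "\<dots> = K * ln (e0 + t)"
    by (simp add: K_def algebra_simps)
  finally have "ln (e0 + k * t) powr q \<le> (K * ln (e0 + t)) powr q"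
    using ln_e0_add_pos[of "k * t"] assms t by (intro powr_mono2) (auto simp: e0_def)
  also have "\<dots> = K powr q * ln (e0 + t) powr q"
    using K ln_e0_add_pos[OF t] by (simp add: powr_mult e0_def)
  finally have "k powr p * t powr p * ln (e0 + k * t) powr q
      \<le> k powr p * t powr p * (K powr q * ln (e0 + t) powr q)"
    by (intro mult_left_mono) auto
  thus "B p q (k * t) \<le> k powr p * K powr q * B p q t"
    using assms t by (simp add: B_def powr_mult e0_def mult_ac)
qed

lemma luxemburg_norm_le:
  assumes "0 < l" "(\<integral>\<^sup>+ x. ennreal (A (\<bar>f x\<bar> / l)) \<partial>M) \<le> 1"
  shows "luxemburg_norm M A f \<le> ennreal l"
  unfolding luxemburg_norm_def using assms by (intro Inf_lower) auto

text \<open>Finiteness of the norm supplies one scale l with modular at most 1; doubling transfers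
  finiteness to every scale c.\<close>

lemma nn_integral_B_finite:
  assumes [measurable]: "f \<in> borel_measurable M"
    and "0 \<le> p" "0 \<le> q" "luxemburg_norm M (B p q) f < \<infinity>" "0 < c"
  shows "(\<integral>\<^sup>+ x. ennreal (B p q (\<bar>f x\<bar> / c)) \<partial>M) < \<infinity>"
proof -
  obtain l where l: "0 < l" "(\<integral>\<^sup>+ x. ennreal (B p q (\<bar>f x\<bar> / l)) \<partial>M) \<le> 1"
    using assms(4) by (auto simp: luxemburg_norm_def Inf_less_iff)
  obtain C where C: "0 \<le> C"
      "\<And>t. 0 \<le> t \<Longrightarrow> B p q (max 1 (l / c) * t) \<le> C * B p q t"
    \<comment> \<open>Doubling requires a factor of at least 1; for l < c, monotonicity covers the
      difference.\<close>
    using B_doubling[of p q "max 1 (l / c)"] assms by auto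
  have "B p q (\<bar>f x\<bar> / c) \<le> C * B p q (\<bar>f x\<bar> / l)" for x
  proof -
    have "l / c * (\<bar>f x\<bar> / l) \<le> max 1 (l / c) * (\<bar>f x\<bar> / l)"
      using l by (intro mult_right_mono) auto
    hence "B p q (\<bar>f x\<bar> / c) \<le> B p q (max 1 (l / c) * (\<bar>f x\<bar> / l))"
      using l assms by (intro B_mono) auto
    also have "\<dots> \<le> C * B p q (\<bar>f x\<bar> / l)"
      using l by (intro C) auto
    finally show ?thesis .
  qed
  hence "(\<integral>\<^sup>+ x. ennreal (B p q (\<bar>f x\<bar> / c)) \<partial>M) \<le> (\<integral>\<^sup>+ x. ennreal C * ennreal (B p q (\<bar>f x\<bar> / l)) \<partial>M)"
    using C by (intro nn_integral_mono) (simp add: B_nonneg flip: ennreal_mult)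
  also have "\<dots> = ennreal C * (\<integral>\<^sup>+ x. ennreal (B p q (\<bar>f x\<bar> / l)) \<partial>M)"
    by (intro nn_integral_cmult) measurable
  also have "\<dots> \<le> ennreal C * 1"
    using l by (intro mult_left_mono) auto
  also have "\<dots> < \<infinity>"
    by simp
  finally show ?thesis .
qed

lemma tendsto_ennreal_powr_0:
  assumes "0 < s" "s < (1::real)" "I < (\<infinity>::ennreal)"
  shows "((\<lambda>q. ennreal (s powr (q - q0)) * I) \<longlongrightarrow> 0) at_top"
proof -
  have "((\<lambda>q. s powr (q - q0)) \<longlongrightarrow> 0) at_top"
    using assms by real_asymp
  hence "((\<lambda>q. ennreal (s powr (q - q0)) * I) \<longlongrightarrow> ennreal 0 * I) at_top"
    using assms by (intro tendsto_mult_ennreal tendsto_ennrealI tendsto_const) auto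
  thus ?thesis by simp
qed

text \<open>
  The factor \<open>ln (e\<^sub>0 + t)\<close> of \<^term>\<open>B p q t\<close> is less than \<open>1\<close> exactly for \<open>t < 1\<close>.
  For \<open>\<parallel>f\<parallel>\<^sub>\<infinity> < c\<close> it therefore stays below some \<open>s < 1\<close> along \<open>t = \<bar>f\<bar> / c\<close>, and the modular
  decays like \<open>s powr q\<close>.
\<close>
lemma eventually_luxemburg_norm_le:
  assumes [measurable]: "f \<in> borel_measurable M"
    and "0 \<le> p" "0 \<le> q0" "luxemburg_norm M (B p q0) f < \<infinity>"
    and c: "Linf_norm M f < ennreal c"
  shows "\<forall>\<^sub>F q in at_top. luxemburg_norm M (B p q) f \<le> ennreal c"
proof -
  \<comment> \<open>For c <= 0, \<open>ennreal c\<close> is 0, and nothing lies strictly below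
    it.\<close>
  have "0 < c"
    using c by (metis ennreal_neg not_le not_less_zero)
  obtain L where L: "Linf_norm M f = ennreal L" "0 \<le> L"
    using c by (metis ennreal_cases ennreal_less_top less_trans less_irrefl)
  hence "L < c"
    using c by (simp add: ennreal_less_iff)
  define s where "s = ln (exp 1 - 1 + L / c)"
  have s: "0 < s" "s < 1"
  proof -
    show "0 < s"
      unfolding s_def using L \<open>0 < c\<close> by (intro ln_e0_add_pos) auto
    have "L / c < 1"
      using \<open>L < c\<close> \<open>0 < c\<close> by simp
    hence "s < ln (exp 1)"
      unfolding s_def using L \<open>0 < c\<close> e0_gt_1
      by (subst ln_less_cancel_iff) (auto intro!: add_pos_nonneg)
    thus "s < 1" by simp
  qed
  define I where "I = (\<integral>\<^sup>+ x. ennreal (B p q0 (\<bar>f x\<bar> / c)) \<partial>M)"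
  have "I < \<infinity>"
    unfolding I_def using assms \<open>0 < c\<close> by (intro nn_integral_B_finite) auto
  have "AE x in M. ennreal \<bar>f x\<bar> \<le> Linf_norm M f"
    unfolding Linf_norm_def by (intro esssup_AE)
  hence AE: "AE x in M. \<bar>f x\<bar> \<le> L"
    using L by simp
  have "\<forall>\<^sub>F q in at_top. ennreal (s powr (q - q0)) * I < 1"
    using order_tendstoD(2)[OF tendsto_ennreal_powr_0[OF s \<open>I < \<infinity>\<close>]] by simp
  thus ?thesis
    using eventually_ge_at_top[of q0]
  proof eventually_elim
    case (elim q)
    have "AE x in M. ennreal (B p q (\<bar>f x\<bar> / c))
        \<le> ennreal (s powr (q - q0)) * ennreal (B p q0 (\<bar>f x\<bar> / c))"
      using AE
    proof eventually_elim
      case (elim x)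
      let ?t = "\<bar>f x\<bar> / c" let ?u = "ln (exp 1 - 1 + ?t)"
      have u: "0 < ?u" "?u \<le> s"
        unfolding s_def using \<open>0 < c\<close> elim
        by (auto intro!: ln_e0_add_pos ln_e0_add_mono divide_right_mono simp del: ln_le_cancel_iff)
      have "B p q ?t = ?u powr (q - q0) * B p q0 ?t"
        using u by (simp add: B_def flip: powr_add)
      also have "\<dots> \<le> s powr (q - q0) * B p q0 ?t"
        using u \<open>q0 \<le> q\<close> by (intro mult_right_mono powr_mono2) (auto simp: B_nonneg)
      finally show ?case
        by (simp add: B_nonneg flip: ennreal_mult)
    qed
    hence "(\<integral>\<^sup>+ x. ennreal (B p q (\<bar>f x\<bar> / c)) \<partial>M)
        \<le> (\<integral>\<^sup>+ x. ennreal (s powr (q - q0)) * ennreal (B p q0 (\<bar>f x\<bar> / c)) \<partial>M)"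
      by (rule nn_integral_mono_AE)
    also have "\<dots> = ennreal (s powr (q - q0)) * I"
      unfolding I_def by (intro nn_integral_cmult) measurable
    finally show ?case
      using elim \<open>0 < c\<close> by (intro luxemburg_norm_le) auto
  qed
qed

text \<open>
  For \<open>l \<le> d < d' < \<parallel>f\<parallel>\<^sub>\<infinity>\<close>, on the set where \<open>\<bar>f\<bar> > d'\<close> the logarithmic factor exceeds a constant
  greater than \<open>1\<close>, so the modular at \<open>l\<close> grows geometrically in \<open>q\<close>, uniformly in \<open>l\<close>.
\<close>
lemma eventually_luxemburg_norm_ge:
  assumes [measurable]: "f \<in> borel_measurable M"
    and "0 \<le> p" "0 < d" and d: "ennreal d < Linf_norm M f"
  shows "\<forall>\<^sub>F q in at_top. ennreal d \<le> luxemburg_norm M (B p q) f"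
proof -
  \<comment> \<open>The strict gap d < d' makes the logarithm at d' / d exceed 1.\<close>
  obtain d' where d': "d < d'" "ennreal d' < Linf_norm M f"
  proof -
    obtain z where "ennreal d < z" "z < Linf_norm M f"
      using dense[OF d] by auto
    thus ?thesis
      using that \<open>0 < d\<close> by (cases z) (auto simp: ennreal_less_iff)
  qed
  define E where "E = {x \<in> space M. d' < \<bar>f x\<bar>}"
  have E [measurable]: "E \<in> sets M"
    unfolding E_def by measurable
  have "E = {x \<in> space M. ennreal d' < ennreal \<bar>f x\<bar>}"
    using d' \<open>0 < d\<close> by (auto simp: E_def ennreal_less_iff)
  hence "0 < emeasure M E"
    using d' esssup_pos_measure[of "\<lambda>x. ennreal \<bar>f x\<bar>" M "ennreal d'"] by (simp add: Linf_norm_def)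
  \<comment> \<open>E may have infinite measure; a real lower bound m lets the growth be stated over
    the reals.\<close>
  then obtain m where m: "0 < m" "ennreal m \<le> emeasure M E"
  proof -
    obtain z where "0 < z" "z < emeasure M E"
      using dense[OF \<open>0 < emeasure M E\<close>] by auto
    thus ?thesis
      using that by (cases z) (auto simp: less_imp_le)
  qed
  define r where "r = ln (exp 1 - 1 + d' / d)"
  have "1 < r"
  proof -
    have "ln (exp 1) < r"
      unfolding r_def using d' \<open>0 < d\<close> e0_gt_1
      by (subst ln_less_cancel_iff) (auto intro!: add_pos_pos)
    thus ?thesis by simp
  qed
  have "filterlim (\<lambda>q. r powr q * m) at_top at_top"
    using \<open>1 < r\<close> m(1) by real_asymp
  hence "\<forall>\<^sub>F q in at_top. 1 < r powr q * m"
    by (simp add: filterlim_at_top_dense)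
  thus ?thesis
    using eventually_ge_at_top[of 0]
  proof eventually_elim
    case (elim q)
    show ?case
      unfolding luxemburg_norm_def
    proof (rule Inf_greatest, clarify)
      fix l :: real
      assume l: "0 < l" "(\<integral>\<^sup>+ x. ennreal (B p q (\<bar>f x\<bar> / l)) \<partial>M) \<le> 1"
      show "ennreal d \<le> ennreal l"
      proof (rule ccontr)
        assume "\<not> ennreal d \<le> ennreal l"
        hence "l < d"
          using l by (meson ennreal_leI not_less)
        have "1 < d' / d"
          using d' \<open>0 < d\<close> by simp
        have "r powr q * 1 \<le> r powr q * (d' / d) powr p"
          using \<open>1 < d' / d\<close> assms by (intro mult_left_mono ge_one_powr_ge_zero) auto
        hence r: "r powr q \<le> B p q (d' / d)"
          by (simp add: B_def r_def mult_ac)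
        \<comment> \<open>The bound does not involve l, so a single threshold for q excludes all l <
          d at once.\<close>
        have *: "r powr q \<le> B p q (\<bar>f x\<bar> / l)" if "x \<in> E" for x
        proof -
          have "d' / d \<le> \<bar>f x\<bar> / l"
            using that d' l \<open>l < d\<close> \<open>0 < d\<close> by (intro frac_le) (auto simp: E_def)
          thus ?thesis
            using r B_mono[of p q "d' / d" "\<bar>f x\<bar> / l"] assms elim \<open>1 < d' / d\<close> by auto
        qed
        have "1 < ennreal (r powr q * m)"
          using elim by (simp flip: ennreal_1 add: ennreal_less_iff)
        also have "\<dots> \<le> ennreal (r powr q) * emeasure M E"
          using m by (simp add: ennreal_mult mult_left_mono)
        also have "\<dots> = (\<integral>\<^sup>+ x. ennreal (r powr q) * indicator E x \<partial>M)"
          by (simp add: nn_integral_cmult_indicator)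
        also have "\<dots> \<le> (\<integral>\<^sup>+ x. ennreal (B p q (\<bar>f x\<bar> / l)) \<partial>M)"
          using * by (intro nn_integral_mono) (auto split: split_indicator intro!: ennreal_leI)
        also note l(2)
        finally show False by simp
      qed
    qed
  qed
qed

theorem theorem1:
  fixes M :: "'a measure" and f :: "'a \<Rightarrow> real" and p q0 :: real
  assumes "f \<in> borel_measurable M"
    and "1 \<le> p"
    and "q0 > 0"
    and "luxemburg_norm M (B p q0) f < \<infinity>"
  shows "((\<lambda>q::real. luxemburg_norm M (B p q) f) \<longlongrightarrow> Linf_norm M f) at_top"
proof (rule order_tendstoI)
  fix a assume "a < Linf_norm M f"
  then obtain z where z: "a < z" "z < Linf_norm M f"
    using dense by auto
  \<comment> \<open>Here d = 0 is impossible since a < z.\<close>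
  then obtain d where d: "z = ennreal d" "0 < d"
    by (cases z) (auto simp: less_eq_real_def)
  have "\<forall>\<^sub>F q in at_top. ennreal d \<le> luxemburg_norm M (B p q) f"
    using assms z d by (intro eventually_luxemburg_norm_ge) auto
  thus "\<forall>\<^sub>F q in at_top. a < luxemburg_norm M (B p q) f"
    by eventually_elim (use z d in auto)
next
  fix a assume "Linf_norm M f < a"
  then obtain z where z: "Linf_norm M f < z" "z < a"
    using dense by auto
  then obtain c where c: "z = ennreal c"
    by (cases z) auto
  have "\<forall>\<^sub>F q in at_top. luxemburg_norm M (B p q) f \<le> ennreal c"
    using assms z c by (intro eventually_luxemburg_norm_le[OF _ _ _ assms(4)]) auto
  thus "\<forall>\<^sub>F q in at_top. luxemburg_norm M (B p q) f < a"
    by eventually_elim (use z c in auto)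
qed

end
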